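(* Let $N\in\mathbb{N}$ and let $\mathcal{A}_N$ be the quantum circuit described in the context. It uses a total of $\frac{3}{2}N^2+\frac{N}{2}-1$ qubits: $N^2$ system qubits and $\frac{N^2}{2}+\frac{N}{2}-1$ ancillary qubits; in particular it uses $\mathcal{O}(N^2)$ qubits. In the state produced by $\mathcal{A}_N$, each of the $N^N$ computational basis states of the system occurring in the superposition $|\Psi\rangle$ is associated with a computational basis state of the ancillas, and all $\frac{N^2}{2}+\frac{N}{2}-1$ associated ancillas are in the state $|1\rangle$ if and only if that system basis state encodes a solution to the $N$-Queens Problem; for every other system basis state in the superposition at least one associated ancilla is in the state $|0\rangle$.
   Context: A configuration of queens on an $N\times N$ chessboard is represented by an $N\times N$ matrix with entries in $\{0,1\}$ ($1$ = queen, $0$ = vacant). It is a solution to the $N$-Queens Problem if every row contains exactly one queen, every column contains exactly one queen, and every diagonal (in both diagonal directions) contains at most one queen. The circuit $\mathcal{A}_N$ acts on $N^2$ system qubits together with $N-1$ column ancillas and $\frac{N(N-1)}{2}$ diagonal ancillas. The system qubits are denoted $q_{xy}$, $x,y\in\{1,\dots,N\}$, where $q_{xy}$ is the $y$-th qubit of the $x$-th block and encodes the matrix entry in row $x$ and column $y$. Initially the system is in the state $|\Psi\rangle=|\psi_1\rangle\otimes\cdots\otimes|\psi_N\rangle$, where each block $|\psi_i\rangle$ is the $N$-qubit $W$ state $\frac{1}{\sqrt N}\sum_{r=1}^{N}|R_r\rangle$ with $R_r$ the $r$-th row of the $N\times N$ identity matrix; thus $|\Psi\rangle$ is a superposition of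 the $N^N$ basis states encoding configurations with exactly one queen in each row. The column ancillas $c_1,\dots,c_{N-1}$ are initially in the state $|0\rangle$ and the diagonal ancillas $\delta_1,\dots,\delta_{N(N-1)/2}$ in the state $|1\rangle$. The gates of $\mathcal{A}_N$ are the following. (1) Column checks. For each $y\in\{1,\dots,N-1\}$: apply a Hadamard gate to $c_y$; then for each $x\in\{1,\dots,N\}$ apply a controlled phase shift $e^{i\pi}$ (controlled-$Z$) with control $c_y$ and target $q_{xy}$; then apply a Hadamard gate to $c_y$ again. (2) Diagonal checks. For all $i,j,x,y\in\{1,\dots,N\}$ with $j>i$ such that the squares $(i,x)$ and $(j,y)$ (row, column) lie on a common diagonal, i.e. $|x-y|=j-i$: apply a Toffoli gate with controls $q_{ix}$ and $q_{jy}$ and target $\delta_k$, where $k=\frac{(i-1)}{2}(2N-i)+(j-i)$. *)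

theory Defs
  imports "HOL-Analysis.Analysis" "HOL-Library.Z2" "HOL-Library.Landau_Symbols"
begin

section \<open>Quantum states and circuits on labelled qubits\<close>

text \<open>
  A register is a finite set of qubit labels. A computational basis state of a register \<open>Q\<close> assigns
  a bit to every label in \<open>Q\<close>; a state vector is given by its amplitudes, which vanish outside
  \<open>basis Q\<close>.
\<close>

type_synonym 'q bstate = "'q \<Rightarrow> bit"
type_synonym 'q qstate = "'q bstate \<Rightarrow> complex"

definition basis :: "'q set \<Rightarrow> 'q bstate set" where
  "basis Q = Q \<rightarrow>\<^sub>E (UNIV :: bit set)"

definition ket :: "'q bstate \<Rightarrow> 'q qstate" where
  "ket s = (\<lambda>b. if b = s then 1 else 0)"

definition tensor :: "'q set \<Rightarrow> 'q qstate \<Rightarrow> 'q set \<Rightarrow> 'q qstate \<Rightarrow> 'q qstate" where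
  "tensor Q \<psi> R \<phi> = (\<lambda>b. if b \<in> basis (Q \<union> R) then \<psi> (restrict b Q) * \<phi> (restrict b R) else 0)"

definition tensor_family :: "'i set \<Rightarrow> ('i \<Rightarrow> 'q set) \<Rightarrow> ('i \<Rightarrow> 'q qstate) \<Rightarrow> 'q qstate" where
  "tensor_family I Q \<psi> =
     (\<lambda>b. if b \<in> basis (\<Union>i\<in>I. Q i) then \<Prod>i\<in>I. \<psi> i (restrict b (Q i)) else 0)"

definition occurring :: "'q qstate \<Rightarrow> 'q bstate set" where
  "occurring \<psi> = {b. \<psi> b \<noteq> 0}"

text \<open>
  \<open>Gate C U t\<close> applies the single-qubit matrix \<open>U\<close> (row index first) to the target \<open>t\<close>, conditioned
  on all the control qubits in \<open>C\<close> being 1.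
\<close>

type_synonym qmatrix = "bit \<Rightarrow> bit \<Rightarrow> complex"

datatype 'q gate = Gate (controls: "'q set") (matrix: qmatrix) (target: 'q)

definition apply_gate :: "'q gate \<Rightarrow> 'q qstate \<Rightarrow> 'q qstate" where
  "apply_gate g \<psi> =
     (\<lambda>b. if \<forall>c\<in>controls g. b c = 1
          then \<Sum>v\<in>{0, 1}. matrix g (b (target g)) v * \<psi> (b(target g := v))
          else \<psi> b)"

definition hadamard :: "'q \<Rightarrow> 'q gate" where
  "hadamard t = Gate {} (\<lambda>u v. (if u = 1 \<and> v = 1 then - 1 else 1) / complex_of_real (sqrt 2)) t"

definition controlled_phase :: "real \<Rightarrow> 'q \<Rightarrow> 'q \<Rightarrow> 'q gate" where
  "controlled_phase \<theta> c t =
     Gate {c} (\<lambda>u v. if u \<noteq> v then 0 else if u = 1 then exp (\<i> * complex_of_real \<theta>) else 1) t"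

definition toffoli :: "'q \<Rightarrow> 'q \<Rightarrow> 'q \<Rightarrow> 'q gate" where
  "toffoli c c' t = Gate {c, c'} (\<lambda>u v. if u \<noteq> v then 1 else 0) t"

record 'q circuit =
  register :: "'q set"
  input_state :: "'q qstate"
  gates :: "'q gate list"

definition num_qubits :: "'q circuit \<Rightarrow> nat" where
  "num_qubits A = card (register A)"

definition output_state :: "'q circuit \<Rightarrow> 'q qstate" where
  "output_state A = fold apply_gate (gates A) (input_state A)"

definition well_formed :: "'q circuit \<Rightarrow> bool" where
  "well_formed A \<longleftrightarrow>
     (\<forall>g\<in>set (gates A). controls g \<subseteq> register A \<and> target g \<in> register A \<and> target g \<notin> controls g)"


section \<open>The N-Queens Problem\<close>

text \<open>
  \<open>M x y = 1\<close> means that there is a queen in row \<open>x\<close> and column \<open>y\<close>. The diagonals of the two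
  directions are the level sets of \<open>x - y\<close> and of \<open>x + y\<close>.
\<close>

definition queens_solution :: "nat \<Rightarrow> (nat \<Rightarrow> nat \<Rightarrow> bit) \<Rightarrow> bool" where
  "queens_solution N M \<longleftrightarrow>
     (\<forall>x\<in>{1..N}. card {y\<in>{1..N}. M x y = 1} = 1) \<and>
     (\<forall>y\<in>{1..N}. card {x\<in>{1..N}. M x y = 1} = 1) \<and>
     (\<forall>d. card {(x, y). x \<in> {1..N} \<and> y \<in> {1..N} \<and> int x - int y = d \<and> M x y = 1} \<le> 1) \<and>
     (\<forall>d. card {(x, y). x \<in> {1..N} \<and> y \<in> {1..N} \<and> x + y = d \<and> M x y = 1} \<le> 1)"


section \<open>The circuit\<close>

datatype qubit = Sys nat nat | Col nat | Diag nat

definition block :: "nat \<Rightarrow> nat \<Rightarrow> qubit set" where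
  "block N x = {Sys x y | y. y \<in> {1..N}}"

definition system_qubits :: "nat \<Rightarrow> qubit set" where
  "system_qubits N = (\<Union>x\<in>{1..N}. block N x)"

definition column_ancillas :: "nat \<Rightarrow> qubit set" where
  "column_ancillas N = Col ` {1..N - 1}"

definition diagonal_ancillas :: "nat \<Rightarrow> qubit set" where
  "diagonal_ancillas N = Diag ` {1..N * (N - 1) div 2}"

definition ancillas :: "nat \<Rightarrow> qubit set" where
  "ancillas N = column_ancillas N \<union> diagonal_ancillas N"

definition encoded_configuration :: "qubit bstate \<Rightarrow> nat \<Rightarrow> nat \<Rightarrow> bit" where
  "encoded_configuration s = (\<lambda>x y. s (Sys x y))"

text \<open>The \<open>r\<close>-th row of the identity matrix, written on the qubits of block \<open>x\<close>.\<close>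

definition identity_row :: "nat \<Rightarrow> nat \<Rightarrow> nat \<Rightarrow> qubit bstate" where
  "identity_row N x r = restrict (\<lambda>q. if q = Sys x r then 1 else 0) (block N x)"

definition W_state :: "nat \<Rightarrow> nat \<Rightarrow> qubit qstate" where
  "W_state N x =
     (\<lambda>b. 1 / complex_of_real (sqrt (real N)) * (\<Sum>r\<in>{1..N}. ket (identity_row N x r) b))"

definition Psi :: "nat \<Rightarrow> qubit qstate" where
  "Psi N = tensor_family {1..N} (block N) (W_state N)"

definition initial_ancillas :: "nat \<Rightarrow> qubit bstate" where
  "initial_ancillas N = restrict (\<lambda>q. if q \<in> diagonal_ancillas N then 1 else 0) (ancillas N)"

definition column_check :: "nat \<Rightarrow> nat \<Rightarrow> qubit gate list" where
  "column_check N y =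
     [hadamard (Col y)] @
     map (\<lambda>x. controlled_phase pi (Col y) (Sys x y)) [1..<Suc N] @
     [hadamard (Col y)]"

text \<open>The product \<open>(i - 1) * (2 * N - i)\<close> is always even, so the division is exact.\<close>

definition diag_index :: "nat \<Rightarrow> nat \<Rightarrow> nat \<Rightarrow> nat" where
  "diag_index N i j = (i - 1) * (2 * N - i) div 2 + (j - i)"

text \<open>
  The Toffoli gates have controls in the system and targets in the ancillas, hence they commute and
  the order in which they are listed is immaterial.
\<close>

definition diagonal_checks :: "nat \<Rightarrow> qubit gate list" where
  "diagonal_checks N =
     [toffoli (Sys i x) (Sys j y) (Diag (diag_index N i j)).
        i \<leftarrow> [1..<Suc N], j \<leftarrow> [1..<Suc N], x \<leftarrow> [1..<Suc N], y \<leftarrow> [1..<Suc N],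
        j > i \<and> \<bar>int x - int y\<bar> = int j - int i]"

definition queens_circuit :: "nat \<Rightarrow> qubit circuit" where
  "queens_circuit N =
     \<lparr> register = system_qubits N \<union> ancillas N,
       input_state = tensor (system_qubits N) (Psi N) (ancillas N) (ket (initial_ancillas N)),
       gates = concat (map (column_check N) [1..<N]) @ diagonal_checks N \<rparr>"

lemma diag_index_bounds:
  assumes "1 \<le> i" "i < j" "j \<le> N"
  shows "diag_index N i j \<in> {1..N * (N - 1) div 2}"
proof -
  obtain m where m: "i = Suc m" using assms(1) by (cases i) auto
  obtain d where d: "j = i + Suc d" using assms(2) less_iff_Suc_add by auto
  obtain e where e: "N = j + e" using assms(3) le_Suc_ex by blast
  have N: "N = m + (d + e + 2)" by (simp add: e d m)
  have "m * (2 * N - i) + 2 * Suc d \<le> N * (N - 1)"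
  proof -
    have "m * (2 * N - i) + 2 * Suc d = m * (m + 2 * d + 2 * e + 3) + 2 * Suc d"
      by (simp add: N m)
    also have "\<dots> \<le> (m + (d + e + 2)) * (m + (d + e + 1))"
      by (simp add: distrib_left distrib_right)
    also have "\<dots> = N * (N - 1)"
      by (simp add: N)
    finally show ?thesis .
  qed
  then have "(m * (2 * N - i) + 2 * Suc d) div 2 \<le> N * (N - 1) div 2"
    by (rule div_le_mono)
  moreover have "(m * (2 * N - i) + 2 * Suc d) div 2 = diag_index N i j"
    unfolding diag_index_def m d by (simp only: div_mult_self2) simp
  ultimately show ?thesis
    unfolding diag_index_def d by simp
qed

lemma set_diagonal_checks:
  "set (diagonal_checks N) =
     {toffoli (Sys i x) (Sys j y) (Diag (diag_index N i j)) | i j x y.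
        i \<in> {1..N} \<and> j \<in> {1..N} \<and> x \<in> {1..N} \<and> y \<in> {1..N} \<and>
        j > i \<and> \<bar>int x - int y\<bar> = int j - int i}"
  unfolding diagonal_checks_def set_concat set_map set_upt image_image UN_simps
  by (intro set_eqI) (simp add: if_distrib[of set] if_distrib[of "(\<in>) _"] less_Suc_eq_le Bex_def cong: if_cong, blast)

lemma Sys_in_system_qubits: "x \<in> {1..N} \<Longrightarrow> y \<in> {1..N} \<Longrightarrow> Sys x y \<in> system_qubits N"
  unfolding system_qubits_def block_def by blast

lemma well_formed_queens_circuit: "well_formed (queens_circuit N)"
  unfolding well_formed_def
proof
  fix g assume "g \<in> set (gates (queens_circuit N))"
  then consider (col) y where "y \<in> {1..<N}" "g \<in> set (column_check N y)"
    | (diag) "g \<in> set (diagonal_checks N)"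
    unfolding queens_circuit_def by auto
  then show "controls g \<subseteq> register (queens_circuit N) \<and> target g \<in> register (queens_circuit N) \<and>
      target g \<notin> controls g"
  proof cases
    case col
    then have "Col y \<in> ancillas N"
      by (auto simp: ancillas_def column_ancillas_def)
    moreover have "g = hadamard (Col y) \<or> (\<exists>x\<in>{1..N}. g = controlled_phase pi (Col y) (Sys x y))"
      using col(2) by (auto simp: column_check_def)
    ultimately show ?thesis
      using Sys_in_system_qubits[of _ N y] col(1)
      by (auto simp: queens_circuit_def hadamard_def controlled_phase_def)
  next
    case diag
    then obtain i j x y where g: "g = toffoli (Sys i x) (Sys j y) (Diag (diag_index N i j))"
      and b: "i \<in> {1..N}" "j \<in> {1..N}" "x \<in> {1..N}" "y \<in> {1..N}" "i < j"
      unfolding set_diagonal_checks by blast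
    have "diag_index N i j \<in> {1..N * (N - 1) div 2}"
      using b by (intro diag_index_bounds) auto
    then have "Diag (diag_index N i j) \<in> ancillas N"
      unfolding ancillas_def diagonal_ancillas_def by blast
    then show ?thesis
      using Sys_in_system_qubits[of i N x] Sys_in_system_qubits[of j N y] b
      by (simp add: queens_circuit_def g toffoli_def)
  qed
qed

end

theory Submission
  imports Defs
begin

text \<open>
  By linearity it is enough to follow one basis state \<open>s\<close> of the superposition. Phase kickback
  turns \<open>c\<^sub>y\<close> into the parity of the number of queens in column \<open>y\<close>. As \<open>N\<close> queens are on the
  board, the first \<open>N - 1\<close> columns have odd numbers of queens only if every column has exactly one. Since every row has a
  single queen and the ancilla index is injective on pairs of rows, at most one Toffoli gate per
  diagonal ancilla fires, so flips never cancel.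
\<close>

section \<open>Linearity and basis states\<close>

text \<open>The obstacle to following a basis state gate by gate is that after its first Hadamard
  gate a column ancilla is in no basis state. Only this one qubit is then in superposition, so two
  amplitudes describe the state (\<open>qubit_superposition\<close>), and the second Hadamard gate
  leads back to a ket. Toffoli gates map kets to kets. Bits are elements of Z/2: a flip is an
  addition and a parity is a plain sum, so whole lists of gates act by closed formulas. On kets, the
  checks change ancillas only and depend on system qubits, hence these formulas refer to the
  original \<open>s\<close> throughout. The result, \<open>final_ancillas N s\<close>, is the
  witness for the associated ancilla state. The number N(N-1)/2 of diagonal ancillas is the number
  of pairs of rows: a single ancilla serves all pairs of squares in its two rows, for both diagonal
  directions.\<close>

lemma apply_gate_linear:
  "apply_gate g (\<lambda>b. \<Sum>s\<in>A. c s * f s b) = (\<lambda>b. \<Sum>s\<in>A. c s * apply_gate g (f s) b)"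
proof
  fix b
  show "apply_gate g (\<lambda>b. \<Sum>s\<in>A. c s * f s b) b = (\<Sum>s\<in>A. c s * apply_gate g (f s) b)"
    by (cases "\<forall>q\<in>controls g. b q = 1")
      (simp_all only: apply_gate_def if_True if_False,
        simp_all add: sum.distrib sum_distrib_left algebra_simps)
qed

text \<open>A gate replaces the family \<open>f\<close> by its images and leaves the coefficients
  alone, so the induction runs with \<open>f\<close> arbitrary.\<close>

lemma fold_apply_gate_linear:
  "fold apply_gate gs (\<lambda>b. \<Sum>s\<in>A. c s * f s b) = (\<lambda>b. \<Sum>s\<in>A. c s * fold apply_gate gs (f s) b)"
  by (induction gs arbitrary: f) (simp_all add: apply_gate_linear)

text \<open>The \<open>restrict\<close> fixes the value \<open>undefined\<close> off the joint
  register, so that basis states can be compared by plain equality of functions.\<close>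

definition merge_states :: "'q set \<Rightarrow> 'q set \<Rightarrow> 'q bstate \<Rightarrow> 'q bstate \<Rightarrow> 'q bstate" where
  "merge_states Q R s a = restrict (\<lambda>q. if q \<in> Q then s q else a q) (Q \<union> R)"

lemma tensor_ket:
  assumes "Q \<inter> R = {}" "s \<in> basis Q" "a \<in> basis R"
  shows "tensor Q (ket s) R (ket a) = ket (merge_states Q R s a)"
proof
  fix b
  have s: "restrict (merge_states Q R s a) Q = s" and a: "restrict (merge_states Q R s a) R = a"
    using assms by (auto simp: merge_states_def basis_def PiE_def extensional_def fun_eq_iff)
  have "b = merge_states Q R (restrict b Q) (restrict b R)" if "b \<in> basis (Q \<union> R)"
    using that by (auto simp: merge_states_def basis_def PiE_def extensional_def fun_eq_iff)
  moreover have "merge_states Q R s a \<in> basis (Q \<union> R)"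
    by (simp add: merge_states_def basis_def)
  ultimately have "b \<in> basis (Q \<union> R) \<and> restrict b Q = s \<and> restrict b R = a \<longleftrightarrow> b = merge_states Q R s a"
    using s a by blast
  then show "tensor Q (ket s) R (ket a) b = ket (merge_states Q R s a) b"
    by (auto simp: tensor_def ket_def)
qed

text \<open>At each \<open>b\<close> only the term with \<open>s = restrict b Q\<close> can survive;
  if that state does not occur, its amplitude is 0 and both sides vanish. Expanding the left factor
  alone gives the form to which linearity of the gates applies.\<close>

lemma tensor_expand:
  assumes "finite (occurring \<psi>)"
  shows "tensor Q \<psi> R \<phi> = (\<lambda>b. \<Sum>s\<in>occurring \<psi>. \<psi> s * tensor Q (ket s) R \<phi> b)"
proof
  fix b
  have "(\<Sum>s\<in>occurring \<psi>. \<psi> s * (ket s (restrict b Q) * \<phi> (restrict b R)))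
      = (\<Sum>s\<in>occurring \<psi>. if s = restrict b Q then \<psi> s * \<phi> (restrict b R) else 0)"
    by (intro sum.cong) (auto simp: ket_def)
  also have "\<dots> = \<psi> (restrict b Q) * \<phi> (restrict b R)"
    using assms by (simp add: occurring_def)
  finally show "tensor Q \<psi> R \<phi> b = (\<Sum>s\<in>occurring \<psi>. \<psi> s * tensor Q (ket s) R \<phi> b)"
    by (simp add: tensor_def)
qed

section \<open>Gates on basis states\<close>

definition phase :: "bit \<Rightarrow> complex" where
  "phase u = (if u = 1 then - 1 else 1)"

text \<open>\<open>phase\<close> is the nontrivial character of Z/2. Being a homomorphism, it turns
  a product of signs into the sign of a parity.\<close>

lemma phase_add: "phase (u + v) = phase u * phase v"
  by (cases u; cases v) (simp_all add: phase_def)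

text \<open>Describes the state between the two Hadamard gates of a column check: qubit
  \<open>t\<close> carries two amplitudes, all other qubits stay as in \<open>b\<close>.\<close>

definition qubit_superposition :: "'q bstate \<Rightarrow> 'q \<Rightarrow> complex \<Rightarrow> complex \<Rightarrow> 'q qstate" where
  "qubit_superposition b t c\<^sub>0 c\<^sub>1 = (\<lambda>b'. c\<^sub>0 * ket (b(t := 0)) b' + c\<^sub>1 * ket (b(t := 1)) b')"

lemma qubit_superposition_ket:
  "qubit_superposition b t 1 0 = ket (b(t := 0))" "qubit_superposition b t 0 1 = ket (b(t := 1))"
  by (simp_all add: qubit_superposition_def)

lemma qubit_superposition_apply:
  "qubit_superposition b t c\<^sub>0 c\<^sub>1 b' =
     (if \<forall>q. q \<noteq> t \<longrightarrow> b' q = b q then if b' t = 1 then c\<^sub>1 else c\<^sub>0 else 0)"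
proof -
  have "b' = b(t := v) \<longleftrightarrow> (\<forall>q. q \<noteq> t \<longrightarrow> b' q = b q) \<and> b' t = v" for v
    by (auto simp: fun_eq_iff)
  then show ?thesis
    by (cases "b' t"; cases "\<forall>q. q \<noteq> t \<longrightarrow> b' q = b q")
      (simp_all only: qubit_superposition_def ket_def, simp_all)
qed

lemma apply_hadamard:
  "apply_gate (hadamard t) (qubit_superposition b t c\<^sub>0 c\<^sub>1) =
     qubit_superposition b t ((c\<^sub>0 + c\<^sub>1) / complex_of_real (sqrt 2)) ((c\<^sub>0 - c\<^sub>1) / complex_of_real (sqrt 2))"
proof
  fix b'
  \<comment> \<open>\<open>P\<close> ignores the value of \<open>b'\<close> at \<open>t\<close>, so
    it is shared by both updates \<open>b'(t := v)\<close> over which the gate sums.\<close>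
  define P where "P \<longleftrightarrow> (\<forall>q. q \<noteq> t \<longrightarrow> b' q = b q)"
  have "qubit_superposition b t c\<^sub>0 c\<^sub>1 (b'(t := v)) = (if P then if v = 1 then c\<^sub>1 else c\<^sub>0 else 0)" for v c\<^sub>0 c\<^sub>1
    unfolding qubit_superposition_apply P_def by auto
  moreover from this[of _ _ "b' t"]
  have "qubit_superposition b t c\<^sub>0 c\<^sub>1 b' = (if P then if b' t = 1 then c\<^sub>1 else c\<^sub>0 else 0)" for c\<^sub>0 c\<^sub>1
    by simp
  ultimately show "apply_gate (hadamard t) (qubit_superposition b t c\<^sub>0 c\<^sub>1) b' = qubit_superposition b t
      ((c\<^sub>0 + c\<^sub>1) / complex_of_real (sqrt 2)) ((c\<^sub>0 - c\<^sub>1) / complex_of_real (sqrt 2)) b'"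
    by (cases P; cases "b' t")
      (simp_all add: apply_gate_def hadamard_def add_divide_distrib diff_divide_distrib)
qed

text \<open>The gate is diagonal and gives the sign -1 exactly where \<open>t\<close> and
  \<open>q\<close> are both 1. On the support \<open>q\<close> holds the fixed bit
  \<open>b q\<close>, so the sign can be attributed to the amplitude of \<open>t\<close> being
  1.\<close>

lemma apply_controlled_phase_pi:
  assumes "q \<noteq> t"
  shows "apply_gate (controlled_phase pi t q) (qubit_superposition b t c\<^sub>0 c\<^sub>1) =
     qubit_superposition b t c\<^sub>0 (c\<^sub>1 * phase (b q))"
proof
  fix b'
  let ?P = "\<forall>q. q \<noteq> t \<longrightarrow> b' q = b q"
  have "apply_gate (controlled_phase pi t q) (qubit_superposition b t c\<^sub>0 c\<^sub>1) b' =
      (if b' t = 1 then phase (b' q) * qubit_superposition b t c\<^sub>0 c\<^sub>1 b' else qubit_superposition b t c\<^sub>0 c\<^sub>1 b')"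
    by (cases "b' q") (simp_all add: apply_gate_def controlled_phase_def phase_def fun_upd_idem)
  also have "\<dots> = qubit_superposition b t c\<^sub>0 (c\<^sub>1 * phase (b q)) b'"
    using assms by (auto simp: qubit_superposition_apply)
  finally show "apply_gate (controlled_phase pi t q) (qubit_superposition b t c\<^sub>0 c\<^sub>1) b' =
     qubit_superposition b t c\<^sub>0 (c\<^sub>1 * phase (b q)) b'" .
qed

lemma fold_controlled_phase_pi:
  assumes "t \<notin> f ` set xs"
  shows "fold apply_gate (map (\<lambda>x. controlled_phase pi t (f x)) xs) (qubit_superposition b t c\<^sub>0 c\<^sub>1) =
     qubit_superposition b t c\<^sub>0 (c\<^sub>1 * phase (\<Sum>x\<leftarrow>xs. b (f x)))"
  using assms
proof (induction xs arbitrary: c\<^sub>1)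
  case Nil
  then show ?case by (simp add: phase_def)
next
  case (Cons x xs)
  then show ?case
    by (auto simp: apply_controlled_phase_pi phase_add mult.assoc simp del: add_bit_eq_xor)
qed

text \<open>For the parity u of the column, the second Hadamard gate produces the amplitudes (1 +
  phase u)/2 and (1 - phase u)/2. One is 1 and the other 0, so the relative sign has become the bit
  u.\<close>

lemma fold_column_check:
  assumes "b (Col y) = 0"
  shows "fold apply_gate (column_check N y) (ket b) = ket (b(Col y := \<Sum>x\<in>{1..N}. b (Sys x y)))"
proof -
  let ?s = "complex_of_real (sqrt 2)" and ?u = "\<Sum>x\<in>{1..N}. b (Sys x y)"
  have s: "?s * ?s = 2"
    by (simp flip: of_real_mult)
  have u: "(\<Sum>x\<leftarrow>[1..<Suc N]. b (Sys x y)) = ?u"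
    by (simp only: interv_sum_list_conv_sum_set_nat atLeastLessThanSuc_atLeastAtMost set_upt)
  have cz: "fold apply_gate (map (\<lambda>x. controlled_phase pi (Col y) (Sys x y)) [1..<Suc N])
      (qubit_superposition b (Col y) c\<^sub>0 c\<^sub>1) = qubit_superposition b (Col y) c\<^sub>0 (c\<^sub>1 * phase ?u)" for c\<^sub>0 c\<^sub>1
    by (subst fold_controlled_phase_pi) (force, simp only: u)
  have "ket b = qubit_superposition b (Col y) 1 0"
    using assms by (simp add: qubit_superposition_ket fun_upd_idem)
  then have "fold apply_gate (column_check N y) (ket b) =
      qubit_superposition b (Col y) ((1 / ?s + 1 / ?s * phase ?u) / ?s) ((1 / ?s - 1 / ?s * phase ?u) / ?s)"
    by (simp add: column_check_def apply_hadamard cz del: upt_Suc One_nat_def)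
  also have "\<dots> = qubit_superposition b (Col y) ((1 + phase ?u) / 2) ((1 - phase ?u) / 2)"
    by (simp add: add_divide_distrib diff_divide_distrib s)
  also have "\<dots> = ket (b(Col y := ?u))"
    by (cases ?u) (simp_all add: phase_def qubit_superposition_ket)
  finally show ?thesis .
qed

text \<open>The check of column \<open>y\<close> changes \<open>Col y\<close> only, whereas the sums
  read \<open>Sys\<close> labels, so the later checks see the same sums. The \<open>THE\<close>
  recovers the column from its label, which lets one function record all updates.\<close>

lemma fold_column_checks:
  assumes "distinct ys" "\<And>y. y \<in> set ys \<Longrightarrow> b (Col y) = 0"
  shows "fold apply_gate (concat (map (column_check N) ys)) (ket b) =
    ket (\<lambda>q. if q \<in> Col ` set ys then \<Sum>x\<in>{1..N}. b (Sys x (THE y. q = Col y)) else b q)"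
  using assms
proof (induction ys arbitrary: b)
  case Nil
  then show ?case by simp
next
  case (Cons y ys)
  let ?b = "b(Col y := \<Sum>x\<in>{1..N}. b (Sys x y))"
  have "fold apply_gate (concat (map (column_check N) (y # ys))) (ket b) =
      fold apply_gate (concat (map (column_check N) ys)) (ket ?b)"
    using Cons.prems by (simp add: fold_column_check)
  also have "\<dots> = ket (\<lambda>q. if q \<in> Col ` set ys then \<Sum>x\<in>{1..N}. ?b (Sys x (THE y. q = Col y)) else ?b q)"
    using Cons.prems by (intro Cons.IH) auto
  also have "\<dots> = ket (\<lambda>q. if q \<in> Col ` set (y # ys)
      then \<Sum>x\<in>{1..N}. b (Sys x (THE y. q = Col y)) else b q)"
    using Cons.prems(1) by (intro arg_cong[of _ _ ket] ext) auto
  finally show ?case .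
qed

section \<open>Toffoli gates and the diagonal checks\<close>

lemma apply_toffoli:
  assumes "c \<noteq> t" "c' \<noteq> t"
  shows "apply_gate (toffoli c c' t) (ket b) = ket (\<lambda>q. b q + (if q = t then b c * b c' else 0))"
proof
  fix b'
  show "apply_gate (toffoli c c' t) (ket b) b' = ket (\<lambda>q. b q + (if q = t then b c * b c' else 0)) b'"
  proof (cases "\<forall>q. q \<noteq> t \<longrightarrow> b' q = b q")
    case True
    \<comment> \<open>When \<open>b'\<close> agrees with \<open>b\<close> off \<open>t\<close>,
      comparing it with the input or the output ket means comparing bits at \<open>t\<close>. The
      claim becomes a check over four bits.\<close>
    have "b'(t := v) = b(t := v)" for v
      using True by auto
    then have upd: "b'(t := v) = b \<longleftrightarrow> v = b t" for v
      by (metis fun_upd_idem_iff)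
    have "b' = b(t := v) \<longleftrightarrow> b' t = v" for v
      using True by (metis \<open>\<And>v. b'(t := v) = b(t := v)\<close> fun_upd_same fun_upd_triv)
    moreover have "(\<lambda>q. b q + (if q = t then b c * b c' else 0)) = b(t := b t + b c * b c')"
      by (rule ext) (simp del: add_bit_eq_xor)
    ultimately have out: "ket (\<lambda>q. b q + (if q = t then b c * b c' else 0)) b' =
        (if b' t = b t + b c * b c' then 1 else 0)"
      by (simp only: ket_def)
    have ctrl: "b' c = b c" "b' c' = b c'" "b' = b \<longleftrightarrow> b' t = b t"
      using True assms upd[of "b' t"] by simp_all
    show ?thesis
      unfolding out
      by (cases "b' t"; cases "b t"; cases "b c"; cases "b c'")
        (simp_all add: apply_gate_def toffoli_def ket_def upd ctrl)
  next
    case False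
    then obtain q where q: "q \<noteq> t" "b' q \<noteq> b q" by blast
    then have "b'(t := v) \<noteq> b" for v
      by (metis fun_upd_other)
    moreover have "b' \<noteq> b"
      using q(2) by metis
    moreover have "b' \<noteq> (\<lambda>q. b q + (if q = t then b c * b c' else 0))"
    proof
      assume "b' = (\<lambda>q. b q + (if q = t then b c * b c' else 0))"
      then have "b' q = b q + (if q = t then b c * b c' else 0)" by (rule fun_cong)
      with q(1) have "b' q = b q" by (simp del: add_bit_eq_xor)
      with q(2) show False by contradiction
    qed
    ultimately show ?thesis
      by (simp add: apply_gate_def toffoli_def ket_def del: add_bit_eq_xor)
  qed
qed

text \<open>No target is a control, so each product \<open>b (c k) * b (c' k)\<close> keeps its
  initial value and the flips of a common target add up modulo 2.\<close>

lemma fold_toffoli: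
  assumes "(c ` set ts \<union> c' ` set ts) \<inter> t ` set ts = {}"
  shows "fold apply_gate (map (\<lambda>k. toffoli (c k) (c' k) (t k)) ts) (ket b) =
    ket (\<lambda>q. b q + (\<Sum>k\<leftarrow>ts. if q = t k then b (c k) * b (c' k) else 0))"
  using assms
proof (induction ts arbitrary: b)
  case Nil
  then show ?case by (simp del: add_bit_eq_xor)
next
  case (Cons k ts)
  have ne: "c k \<noteq> t k" "c' k \<noteq> t k" using Cons.prems by auto
  let ?b = "\<lambda>q. b q + (if q = t k then b (c k) * b (c' k) else 0)"
  have "fold apply_gate (map (\<lambda>k. toffoli (c k) (c' k) (t k)) (k # ts)) (ket b) =
      fold apply_gate (map (\<lambda>k. toffoli (c k) (c' k) (t k)) ts) (ket ?b)"
    by (simp add: apply_toffoli[OF ne])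
  also have "\<dots> = ket (\<lambda>q. ?b q + (\<Sum>k\<leftarrow>ts. if q = t k then ?b (c k) * ?b (c' k) else 0))"
    using Cons.prems by (intro Cons.IH) auto
  also have "(\<lambda>q. \<Sum>k\<leftarrow>ts. if q = t k then ?b (c k) * ?b (c' k) else 0) =
      (\<lambda>q. \<Sum>k\<leftarrow>ts. if q = t k then b (c k) * b (c' k) else 0)"
    using Cons.prems
    by (intro ext arg_cong[of _ _ sum_list] map_cong refl if_cong arg_cong2[of _ _ _ _ "(*)"])
      (auto simp: image_iff)
  finally show ?case by (simp only: add.assoc sum_list.Cons list.map)
qed

text \<open>The quadruple \<open>(i, j, x, y)\<close> stands for the squares \<open>(i, x)\<close>
  and \<open>(j, y)\<close>. Ordering the rows lists each pair once; the absolute value covers both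
  directions.\<close>

definition diagonal_pairs :: "nat \<Rightarrow> (nat \<times> nat \<times> nat \<times> nat) set" where
  "diagonal_pairs N = {(i, j, x, y). i \<in> {1..N} \<and> j \<in> {1..N} \<and> x \<in> {1..N} \<and> y \<in> {1..N} \<and>
     j > i \<and> \<bar>int x - int y\<bar> = int j - int i}"

text \<open>With \<open>concat_map_product\<close>, this turns the nested comprehension in
  \<open>diagonal_checks\<close> into one \<open>map\<close> over a filtered product, to which
  \<open>fold_toffoli\<close> applies.\<close>

lemma map_filter_eq_concat: "map f (filter P xs) = concat (map (\<lambda>x. if P x then [f x] else []) xs)"
  by (induction xs) simp_all

lemma concat_map_product:
  "concat (map f (List.product xs ys)) = concat (map (\<lambda>x. concat (map (\<lambda>y. f (x, y)) ys)) xs)"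
  by (induction xs) (simp_all add: comp_def)

lemma fold_diagonal_checks:
  "fold apply_gate (diagonal_checks N) (ket b) =
    ket (\<lambda>q. b q + (\<Sum>(i, j, x, y)\<in>diagonal_pairs N.
       if q = Diag (diag_index N i j) then b (Sys i x) * b (Sys j y) else 0))"
proof -
  define ts where "ts = filter (\<lambda>(i, j, x, y). j > i \<and> \<bar>int x - int y\<bar> = int j - int i)
      (List.product [1..<Suc N] (List.product [1..<Suc N] (List.product [1..<Suc N] [1..<Suc N])))"
  \<comment> \<open>Repeated entries could cancel in Z/2; distinctness justifies replacing the list
    sum by a sum over \<open>diagonal_pairs N\<close>.\<close>
  have "distinct ts"
    unfolding ts_def by (intro distinct_filter distinct_product distinct_upt)
  have set_ts: "set ts = diagonal_pairs N"
    unfolding ts_def diagonal_pairs_def by auto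
  have "diagonal_checks N =
      map (\<lambda>k. case k of (i, j, x, y) \<Rightarrow> toffoli (Sys i x) (Sys j y) (Diag (diag_index N i j))) ts"
    unfolding diagonal_checks_def ts_def map_filter_eq_concat concat_map_product
    by (simp only: prod.case)
  also have "\<dots> = map (\<lambda>k. toffoli (case k of (i, j, x, y) \<Rightarrow> Sys i x) (case k of (i, j, x, y) \<Rightarrow> Sys j y)
      (case k of (i, j, x, y) \<Rightarrow> Diag (diag_index N i j))) ts"
    by (intro map_cong) auto
  finally have eq: "diagonal_checks N = \<dots>" .
  show ?thesis
    unfolding eq
  proof (subst fold_toffoli, goal_cases)
    case 1
    show ?case by force
  next
    case 2
    show ?case
      unfolding sum_list_distinct_conv_sum_set[OF \<open>distinct ts\<close>] set_ts
      by (intro arg_cong[of _ _ ket] ext arg_cong2[of _ _ _ _ "(+)"] refl sum.cong) auto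
  qed
qed

section \<open>The superposition of one queen per row\<close>

definition row_configuration :: "nat \<Rightarrow> (nat \<Rightarrow> nat) \<Rightarrow> qubit bstate" where
  "row_configuration N r = restrict (\<lambda>q. case q of Sys x y \<Rightarrow> if y = r x then 1 else 0 | _ \<Rightarrow> 0) (system_qubits N)"

lemma system_qubits_eq: "system_qubits N = {Sys x y | x y. x \<in> {1..N} \<and> y \<in> {1..N}}"
  by (auto simp: system_qubits_def block_def)

lemma row_configuration_apply:
  "x \<in> {1..N} \<Longrightarrow> y \<in> {1..N} \<Longrightarrow> row_configuration N r (Sys x y) = (if y = r x then 1 else 0)"
  by (simp add: row_configuration_def Sys_in_system_qubits)

lemma row_configuration_basis: "row_configuration N r \<in> basis (system_qubits N)"
  by (simp add: row_configuration_def basis_def)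

text \<open>All terms of the \<open>W\<close> state have the same sign, so nothing cancels: up to
  the prefactor the amplitude is a cardinality, nonzero iff the set is inhabited.\<close>

lemma W_state_nonzero:
  assumes "N \<ge> 1"
  shows "W_state N x b \<noteq> 0 \<longleftrightarrow> (\<exists>r\<in>{1..N}. b = identity_row N x r)"
proof -
  have "(\<Sum>r\<in>{1..N}. ket (identity_row N x r) b) = of_nat (card {r\<in>{1..N}. b = identity_row N x r})"
    by (simp add: ket_def sum.If_cases Int_def flip: of_bool_def)
  then show ?thesis
    using assms by (auto simp: W_state_def)
qed

lemma occurring_Psi:
  assumes "N \<ge> 1"
  shows "occurring (Psi N) = row_configuration N ` ({1..N} \<rightarrow>\<^sub>E {1..N})"
proof (intro set_eqI iffI)
  fix b assume "b \<in> occurring (Psi N)"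
  then have b: "b \<in> basis (system_qubits N)"
    and "\<forall>x\<in>{1..N}. \<exists>r\<in>{1..N}. restrict b (block N x) = identity_row N x r"
    by (auto simp: occurring_def Psi_def tensor_family_def system_qubits_def W_state_nonzero[OF assms]
        split: if_splits)
  then obtain r where r: "\<And>x. x \<in> {1..N} \<Longrightarrow> r x \<in> {1..N} \<and> restrict b (block N x) = identity_row N x (r x)"
    by metis
  \<comment> \<open>The chosen \<open>r\<close> is arbitrary off \<open>{1..N}\<close>; restricting
    it puts it into the extensional function space, whose cardinality is
    \<open>N ^ N\<close>.\<close>
  have "b = row_configuration N (restrict r {1..N})"
  proof (rule extensionalityI[where A = "system_qubits N"])
    fix q assume "q \<in> system_qubits N"
    then obtain x y where q: "q = Sys x y" "x \<in> {1..N}" "y \<in> {1..N}"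
      by (auto simp: system_qubits_eq)
    then have "b q = restrict b (block N x) q" by (simp add: block_def)
    also have "\<dots> = row_configuration N (restrict r {1..N}) q"
      using r[OF q(2)] q by (simp add: identity_row_def row_configuration_apply block_def)
    finally show "b q = row_configuration N (restrict r {1..N}) q" .
  qed (use b row_configuration_basis in \<open>auto simp: basis_def PiE_def\<close>)
  moreover have "restrict r {1..N} \<in> {1..N} \<rightarrow>\<^sub>E {1..N}"
    using r by auto
  ultimately show "b \<in> row_configuration N ` ({1..N} \<rightarrow>\<^sub>E {1..N})"
    by blast
next
  fix b assume "b \<in> row_configuration N ` ({1..N} \<rightarrow>\<^sub>E {1..N})"
  then obtain r where r: "r \<in> {1..N} \<rightarrow>\<^sub>E {1..N}" and b: "b = row_configuration N r"
    by blast
  have "restrict b (block N x) = identity_row N x (r x)" if "x \<in> {1..N}" for x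
    using that by (auto simp: b row_configuration_apply block_def identity_row_def restrict_def fun_eq_iff
        split: if_splits)
  then have "W_state N x (restrict b (block N x)) \<noteq> 0" if "x \<in> {1..N}" for x
    unfolding W_state_nonzero[OF assms] using that r by (auto simp: PiE_iff)
  then show "b \<in> occurring (Psi N)"
    using row_configuration_basis[of N r] b
    by (simp add: occurring_def Psi_def tensor_family_def del: One_nat_def flip: system_qubits_def)
qed

lemma inj_on_row_configuration: "inj_on (row_configuration N) ({1..N} \<rightarrow>\<^sub>E {1..N})"
proof (rule inj_onI)
  fix r r' assume r: "r \<in> {1..N} \<rightarrow>\<^sub>E {1..N}" and r': "r' \<in> {1..N} \<rightarrow>\<^sub>E {1..N}"
    and eq: "row_configuration N r = row_configuration N r'"
  show "r = r'"
  proof (rule PiE_ext[OF r r'])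
    fix x assume "x \<in> {1..N}"
    then show "r x = r' x"
      \<comment> \<open>Both configurations are compared at the square \<open>(x, r x)\<close>,
        where the first has a queen.\<close>
      using r row_configuration_apply[of x N "r x" r] row_configuration_apply[of x N "r x" r'] eq
      by (auto simp: PiE_iff split: if_splits)
  qed
qed

lemma card_occurring_Psi:
  assumes "N \<ge> 1"
  shows "card (occurring (Psi N)) = N ^ N"
  unfolding occurring_Psi[OF assms] card_image[OF inj_on_row_configuration] by (simp add: card_PiE)

section \<open>Column and diagonal conditions\<close>

lemma of_nat_bit_eq_1_iff: "(of_nat n :: bit) = 1 \<longleftrightarrow> odd n"
  by (induction n) auto

text \<open>
  The last column needs no ancilla: odd counts in the other columns account for at least \<open>N - 1\<close> of
  the \<open>N\<close> queens, and an extra queen in one of them would come with a second one.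
\<close>

lemma all_fibres_singleton_iff_odd:
  fixes r :: "nat \<Rightarrow> nat"
  assumes "N \<ge> 1" "r \<in> {1..N} \<rightarrow> {1..N}"
  shows "(\<forall>y\<in>{1..N}. card {x\<in>{1..N}. r x = y} = 1) \<longleftrightarrow> (\<forall>y\<in>{1..N - 1}. odd (card {x\<in>{1..N}. r x = y}))"
proof
  assume odd: "\<forall>y\<in>{1..N - 1}. odd (card {x\<in>{1..N}. r x = y})"
  define c where "c y = card {x\<in>{1..N}. r x = y}" for y
  have odd_c: "odd (c y)" if "y \<in> {1..N - 1}" for y
    using odd that by (simp add: c_def)
  have "(\<Sum>y\<in>{1..N}. c y) = card (\<Union>y\<in>{1..N}. {x\<in>{1..N}. r x = y})"
    unfolding c_def by (subst card_UN_disjoint) auto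
  also have "(\<Union>y\<in>{1..N}. {x\<in>{1..N}. r x = y}) = {1..N}"
    using assms by auto
  finally have total: "(\<Sum>y\<in>{1..N}. c y) = N" by simp
  have split: "{1..N} = insert N {1..N - 1}" and notin: "N \<notin> {1..N - 1}"
    using assms by auto
  have le: "c N + (\<Sum>y\<in>{1..N - 1}. c y) = N"
    using total unfolding split by (simp only: sum.insert[OF finite_atLeastAtMost notin])
  have one: "c y = 1" if "y \<in> {1..N - 1}" for y
  proof (rule ccontr)
    assume "c y \<noteq> 1"
    with odd_c[OF that] have "c y \<ge> 3"
      by presburger
    moreover have "(\<Sum>z\<in>{1..N - 1} - {y}. 1) \<le> (\<Sum>z\<in>{1..N - 1} - {y}. c z)"
    proof (rule sum_mono)
      fix z assume "z \<in> {1..N - 1} - {y}"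
      then have "odd (c z)" by (intro odd_c) auto
      then show "1 \<le> c z" by presburger
    qed
    moreover have "(\<Sum>z\<in>{1..N - 1}. c z) = c y + (\<Sum>z\<in>{1..N - 1} - {y}. c z)"
      using that by (intro sum.remove) auto
    ultimately show False
      using le that by (auto simp: card_Diff_singleton)
  qed
  then have "(\<Sum>y\<in>{1..N - 1}. c y) = (\<Sum>y\<in>{1..N - 1}. 1)"
    by (intro sum.cong refl)
  then have "c N = 1"
    using le assms(1) by simp
  with one have "\<forall>y\<in>{1..N}. c y = 1"
    unfolding split by blast
  then show "\<forall>y\<in>{1..N}. card {x\<in>{1..N}. r x = y} = 1"
    by (simp only: c_def)
qed auto

section \<open>The numbering of pairs of rows\<close>

lemma diag_index_less:
  assumes "1 \<le> i" "i < j" "j \<le> N" "i < i'" "i' < j'" "j' \<le> N"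
  shows "diag_index N i j < diag_index N i' j'"
proof -
  \<comment> \<open>Row i has N - i later rows as partners, and \<open>T k\<close> is the sum of N -
    i over i < k, the number of pairs whose first row precedes \<open>k\<close>. The pairs with
    first row \<open>i\<close> thus receive the numbers \<open>T i + 1\<close> to
    \<open>T (Suc i)\<close>.\<close>
  define T where "T k = (k - 1) * (2 * N - k) div 2" for k
  have step: "T (Suc k) = T k + (N - k)" if "1 \<le> k" "k < N" for k
  proof -
    obtain m where m: "k = Suc m" using \<open>1 \<le> k\<close> by (cases k) auto
    obtain e where e: "N = Suc k + e" using \<open>k < N\<close> by (metis Suc_leI le_Suc_ex)
    \<comment> \<open>The increment is twice \<open>N - k\<close>, so it passes exactly through the
      truncating \<open>div 2\<close>.\<close>
    have "k * (2 * N - Suc k) = (k - 1) * (2 * N - k) + 2 * (N - k)"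
      by (simp add: e m algebra_simps)
    then show ?thesis by (simp add: T_def)
  qed
  have mono: "T (Suc i) \<le> T (Suc i + d)" if "Suc i + d \<le> N" for d
    using that assms(1)
  proof (induction d)
    case (Suc d)
    then show ?case using step[of "Suc i + d"] by simp
  qed simp
  have "diag_index N i j \<le> T i + (N - i)"
    using assms by (simp add: diag_index_def T_def)
  also have "\<dots> = T (Suc i)" using assms step by simp
  also have "\<dots> \<le> T i'" using mono[of "i' - Suc i"] assms by simp
  \<comment> \<open>Strict because \<open>j' - i'\<close> is at least 1: the numbers of a block
    start one above \<open>T i'\<close>.\<close>
  also have "\<dots> < diag_index N i' j'" using assms by (simp add: diag_index_def T_def)
  finally show ?thesis .
qed

lemma diag_index_inject:
  assumes "1 \<le> i" "i < j" "j \<le> N" "1 \<le> i'" "i' < j'" "j' \<le> N"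
    and eq: "diag_index N i j = diag_index N i' j'"
  shows "i = i' \<and> j = j'"
proof -
  have "i = i'"
    using diag_index_less[of i j N i' j'] diag_index_less[of i' j' N i j] assms
    by (cases i i' rule: linorder_cases) auto
  with assms show ?thesis by (simp add: diag_index_def)
qed

section \<open>Solutions among placements with one queen per row\<close>

lemma queens_solution_row_configuration:
  assumes "r \<in> {1..N} \<rightarrow> {1..N}"
    and M: "\<And>x y. x \<in> {1..N} \<Longrightarrow> y \<in> {1..N} \<Longrightarrow> M x y = 1 \<longleftrightarrow> y = r x"
  shows "queens_solution N M \<longleftrightarrow> (\<forall>y\<in>{1..N}. card {x\<in>{1..N}. r x = y} = 1) \<and>
    (\<forall>i\<in>{1..N}. \<forall>j\<in>{1..N}. i < j \<longrightarrow> \<bar>int (r i) - int (r j)\<bar> \<noteq> int j - int i)"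
proof -
  have r: "r x \<in> {1..N}" if "x \<in> {1..N}" for x using assms(1) that by auto
  have "{y\<in>{1..N}. M x y = 1} = {r x}" if "x \<in> {1..N}" for x
    using M[OF that] r[OF that] by auto
  then have rows: "\<forall>x\<in>{1..N}. card {y\<in>{1..N}. M x y = 1} = 1"
    by simp
  have cols: "{x\<in>{1..N}. M x y = 1} = {x\<in>{1..N}. r x = y}" if "y \<in> {1..N}" for y
    using M that by auto
  \<comment> \<open>\<open>f\<close> is either diagonal coordinate, the integer difference or the
    natural sum, so one argument serves both directions. The queens lie on the graph of
    \<open>r\<close>, hence those on a diagonal can be counted by their rows.\<close>
  have diag: "card {(x, y). x \<in> {1..N} \<and> y \<in> {1..N} \<and> f x y = d \<and> M x y = 1} \<le> 1 \<longleftrightarrow>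
      (\<forall>i\<in>{1..N}. \<forall>j\<in>{1..N}. f i (r i) = d \<longrightarrow> f j (r j) = d \<longrightarrow> i = j)"
    for f :: "nat \<Rightarrow> nat \<Rightarrow> 'a" and d
  proof -
    have "{(x, y). x \<in> {1..N} \<and> y \<in> {1..N} \<and> f x y = d \<and> M x y = 1} =
        (\<lambda>x. (x, r x)) ` {x\<in>{1..N}. f x (r x) = d}"
      using M r by auto
    then show ?thesis
      by (auto simp: card_image inj_on_def card_le_Suc0_iff_eq)
  qed
  \<comment> \<open>For i < j, the equation r i - r j = j - i says that the two queens have the same
    coordinate sum, and r j - r i = j - i that they have the same coordinate difference.\<close>
  have "(\<forall>d. \<forall>i\<in>{1..N}. \<forall>j\<in>{1..N}. int i - int (r i) = d \<longrightarrow> int j - int (r j) = d \<longrightarrow> i = j) \<and>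
      (\<forall>d. \<forall>i\<in>{1..N}. \<forall>j\<in>{1..N}. i + r i = d \<longrightarrow> j + r j = d \<longrightarrow> i = j) \<longleftrightarrow>
      (\<forall>i\<in>{1..N}. \<forall>j\<in>{1..N}. i < j \<longrightarrow> \<bar>int (r i) - int (r j)\<bar> \<noteq> int j - int i)" (is "?L \<longleftrightarrow> ?R")
  proof
    assume L: ?L
    have sep: "i = j" if "i \<in> {1..N}" "j \<in> {1..N}"
      "int i - int (r i) = int j - int (r j) \<or> i + r i = j + r j" for i j
      using L that by metis
    show ?R
    proof (intro ballI impI)
      fix i j assume ij: "i \<in> {1..N}" "j \<in> {1..N}" "i < j"
      then have "int i - int (r i) \<noteq> int j - int (r j)" "i + r i \<noteq> j + r j"
        using sep[OF ij(1,2)] by (metis less_irrefl)+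
      then show "\<bar>int (r i) - int (r j)\<bar> \<noteq> int j - int i" by linarith
    qed
  next
    assume R: ?R
    have ne: "int i - int (r i) \<noteq> int j - int (r j) \<and> i + r i \<noteq> j + r j"
      if "i \<in> {1..N}" "j \<in> {1..N}" "i < j" for i j
    proof -
      have "\<bar>int (r i) - int (r j)\<bar> \<noteq> int j - int i"
        using R that by blast
      then show ?thesis
        using that(3) by (intro conjI notI; linarith)
    qed
    have "i = j" if "i \<in> {1..N}" "j \<in> {1..N}"
      "int i - int (r i) = int j - int (r j) \<or> i + r i = j + r j" for i j
      using ne[of i j] ne[of j i] that by (metis linorder_less_linear)
    then show ?L by metis
  qed
  then show ?thesis
    unfolding queens_solution_def diag using rows cols by simp
qed

section \<open>The final ancillas\<close>

text \<open>The leading \<open>1 +\<close> in the diagonal case is the initial value of these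
  ancillas; column ancillas start at 0 and hold just the parity.\<close>

definition final_ancillas :: "nat \<Rightarrow> qubit bstate \<Rightarrow> qubit bstate" where
  "final_ancillas N s = restrict (\<lambda>q. case q of
      Col y \<Rightarrow> \<Sum>x\<in>{1..N}. s (Sys x y)
    | Diag k \<Rightarrow> 1 + (\<Sum>(i, j, x, y)\<in>diagonal_pairs N.
        if diag_index N i j = k then s (Sys i x) * s (Sys j y) else 0)
    | _ \<Rightarrow> 0) (ancillas N)"

lemma system_inter_ancillas: "system_qubits N \<inter> ancillas N = {}"
  by (auto simp: system_qubits_eq ancillas_def column_ancillas_def diagonal_ancillas_def)

lemma Diag_diag_index_in_ancillas:
  "(i, j, x, y) \<in> diagonal_pairs N \<Longrightarrow> Diag (diag_index N i j) \<in> ancillas N"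
  using diag_index_bounds[of i j N]
  by (auto simp: diagonal_pairs_def ancillas_def diagonal_ancillas_def)

text \<open>Column checks write only \<open>Col\<close> labels, and Toffoli gates read only
  \<open>Sys\<close> labels and write only \<open>Diag\<close> labels. Both stages therefore
  evaluate the unchanged \<open>s\<close>, and each ancilla can be treated separately.\<close>

lemma fold_gates_queens_circuit:
  assumes "s \<in> basis (system_qubits N)"
  shows "fold apply_gate (gates (queens_circuit N))
      (tensor (system_qubits N) (ket s) (ancillas N) (ket (initial_ancillas N))) =
    tensor (system_qubits N) (ket s) (ancillas N) (ket (final_ancillas N s))"
proof -
  let ?m = "merge_states (system_qubits N) (ancillas N) s (initial_ancillas N)"
  let ?m' = "merge_states (system_qubits N) (ancillas N) s (final_ancillas N s)"
  have init: "initial_ancillas N \<in> basis (ancillas N)" and final: "final_ancillas N s \<in> basis (ancillas N)"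
    by (simp_all add: basis_def initial_ancillas_def final_ancillas_def)
  define b where "b = (\<lambda>q. if q \<in> Col ` set [1..<N] then \<Sum>x\<in>{1..N}. ?m (Sys x (THE y. q = Col y)) else ?m q)"
  have sys: "?m (Sys x y) = s (Sys x y)" if "x \<in> {1..N}" "y \<in> {1..N}" for x y
    using Sys_in_system_qubits[OF that] by (simp add: merge_states_def)
  have col: "?m (Col y) = 0" if "y \<in> set [1..<N]" for y
  proof -
    have "y \<in> {1..N - 1}" using that by auto
    then have "Col y \<in> ancillas N"
      unfolding ancillas_def column_ancillas_def by blast
    moreover have "Col y \<notin> system_qubits N" "Col y \<notin> diagonal_ancillas N"
      by (auto simp: system_qubits_eq diagonal_ancillas_def)
    ultimately show ?thesis
      by (simp add: merge_states_def initial_ancillas_def)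
  qed
  have "gates (queens_circuit N) = concat (map (column_check N) [1..<N]) @ diagonal_checks N"
    unfolding queens_circuit_def circuit.select_convs by (rule refl)
  moreover have "fold apply_gate (concat (map (column_check N) [1..<N])) (ket ?m) = ket b"
    unfolding b_def by (rule fold_column_checks[where ys = "[1..<N]" and b = ?m, OF distinct_upt col])
  ultimately have "fold apply_gate (gates (queens_circuit N)) (ket ?m) = fold apply_gate (diagonal_checks N) (ket b)"
    by (simp only: fold_append comp_apply)
  also have "\<dots> = ket (\<lambda>q. b q + (\<Sum>(i, j, x, y)\<in>diagonal_pairs N.
       if q = Diag (diag_index N i j) then b (Sys i x) * b (Sys j y) else 0))"
    by (rule fold_diagonal_checks)
  also have "(\<lambda>q. b q + (\<Sum>(i, j, x, y)\<in>diagonal_pairs N.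
       if q = Diag (diag_index N i j) then b (Sys i x) * b (Sys j y) else 0)) = ?m'"
  proof
    fix q
    have sum: "(\<Sum>(i, j, x, y)\<in>diagonal_pairs N.
        if q = Diag (diag_index N i j) then b (Sys i x) * b (Sys j y) else 0) =
      (\<Sum>(i, j, x, y)\<in>diagonal_pairs N.
        if q = Diag (diag_index N i j) then s (Sys i x) * s (Sys j y) else 0)"
      by (intro sum.cong) (auto simp: diagonal_pairs_def b_def sys)
    show "b q + (\<Sum>(i, j, x, y)\<in>diagonal_pairs N.
        if q = Diag (diag_index N i j) then b (Sys i x) * b (Sys j y) else 0) = ?m' q"
    proof (cases "q \<in> ancillas N")
      case False
      \<comment> \<open>This case includes labels outside the register: all Toffoli targets are
        ancillas, so the value \<open>undefined\<close> there survives as well.\<close>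
      then have "(\<Sum>(i, j, x, y)\<in>diagonal_pairs N.
        if q = Diag (diag_index N i j) then s (Sys i x) * s (Sys j y) else 0) = 0"
        using Diag_diag_index_in_ancillas by (intro sum.neutral) auto
      moreover have "b q = ?m q"
        using False by (auto simp: b_def ancillas_def column_ancillas_def)
      ultimately show ?thesis
        using False unfolding sum by (simp add: merge_states_def)
    next
      case True
      then have ns: "q \<notin> system_qubits N" using system_inter_ancillas by blast
      have m': "?m' q = final_ancillas N s q"
        using True ns by (simp add: merge_states_def)
      from True consider y where "q = Col y" "y \<in> {1..N - 1}"
        | k where "q = Diag k" "k \<in> {1..N * (N - 1) div 2}"
        unfolding ancillas_def column_ancillas_def diagonal_ancillas_def by blast
      then show ?thesis
      proof cases
        case 1
        then have y: "y \<in> set [1..<N]" "y \<in> {1..N}" by auto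
        have "b q = (\<Sum>x\<in>{1..N}. ?m (Sys x y))"
          using y(1) by (simp add: b_def 1(1))
        also have "\<dots> = (\<Sum>x\<in>{1..N}. s (Sys x y))"
          using y(2) by (intro sum.cong refl sys)
        also have "\<dots> = final_ancillas N s q"
          using True by (simp add: final_ancillas_def 1(1))
        finally have "b q = final_ancillas N s q" .
        moreover have "(\<Sum>(i, j, x, y)\<in>diagonal_pairs N.
            if q = Diag (diag_index N i j) then s (Sys i x) * s (Sys j y) else 0) = 0"
          by (intro sum.neutral) (simp add: 1(1))
        ultimately show ?thesis
          by (simp only: sum m' add_0_right)
      next
        case 2
        then have "q \<in> diagonal_ancillas N"
          unfolding diagonal_ancillas_def by blast
        then have "?m q = 1"
          using True ns by (simp add: merge_states_def initial_ancillas_def)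
        moreover have "q \<notin> Col ` set [1..<N]"
          using 2(1) by blast
        ultimately have "b q = 1"
          by (simp only: b_def if_False)
        moreover have "q = Diag d \<longleftrightarrow> d = k" for d
          using 2(1) by blast
        moreover have "final_ancillas N s q = 1 + (\<Sum>(i, j, x, y)\<in>diagonal_pairs N.
            if diag_index N i j = k then s (Sys i x) * s (Sys j y) else 0)"
          using True by (simp add: final_ancillas_def 2(1) del: add_bit_eq_xor)
        ultimately show ?thesis
          unfolding sum by (simp only: m')
      qed
    qed
  qed
  finally show ?thesis
    unfolding tensor_ket[OF system_inter_ancillas assms init] tensor_ket[OF system_inter_ancillas assms final] .
qed

lemma final_ancillas_Col:
  assumes "y \<in> {1..N - 1}"
  shows "final_ancillas N (row_configuration N r) (Col y) = 1 \<longleftrightarrow> odd (card {x\<in>{1..N}. r x = y})"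
proof -
  have "final_ancillas N (row_configuration N r) (Col y) = (\<Sum>x\<in>{1..N}. row_configuration N r (Sys x y))"
    using assms by (simp add: final_ancillas_def ancillas_def column_ancillas_def)
  also have "\<dots> = (\<Sum>x\<in>{1..N}. of_bool (r x = y))"
    using assms by (intro sum.cong) (auto simp: row_configuration_apply)
  also have "\<dots> = of_nat (card {x\<in>{1..N}. r x = y})"
    by (simp add: of_bool_def sum.If_cases Int_def)
  finally show ?thesis by (simp add: of_nat_bit_eq_1_iff)
qed

lemma final_ancillas_Diag:
  assumes "Diag k \<in> ancillas N" "r \<in> {1..N} \<rightarrow> {1..N}"
  shows "final_ancillas N (row_configuration N r) (Diag k) = 1 \<longleftrightarrow>
    (\<forall>i\<in>{1..N}. \<forall>j\<in>{1..N}. i < j \<and> diag_index N i j = k \<longrightarrow> \<bar>int (r i) - int (r j)\<bar> \<noteq> int j - int i)"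
proof -
  \<comment> \<open>\<open>?A\<close> collects the Toffoli gates that fire on \<open>Diag k\<close>:
    both controls are 1 exactly when \<open>x\<close> and \<open>y\<close> are the queens'
    columns.\<close>
  let ?A = "{(i, j, x, y) \<in> diagonal_pairs N. diag_index N i j = k \<and> x = r i \<and> y = r j}"
  have fin: "finite (diagonal_pairs N)"
    by (rule finite_subset[of _ "{1..N} \<times> {1..N} \<times> {1..N} \<times> {1..N}"]) (auto simp: diagonal_pairs_def)
  then have finA: "finite ?A" by (rule rev_finite_subset) auto
  have "final_ancillas N (row_configuration N r) (Diag k) = 1 + (\<Sum>(i, j, x, y)\<in>diagonal_pairs N.
      if diag_index N i j = k then row_configuration N r (Sys i x) * row_configuration N r (Sys j y) else 0)"
    using assms(1) by (simp add: final_ancillas_def)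
  also have "\<dots> = 1 + (\<Sum>t\<in>diagonal_pairs N. of_bool (t \<in> ?A))"
    by (intro arg_cong2[of _ _ _ _ "(+)"] sum.cong)
      (auto simp: diagonal_pairs_def row_configuration_apply split: if_splits)
  also have "(\<Sum>t\<in>diagonal_pairs N. of_bool (t \<in> ?A)) = (of_nat (card ?A) :: bit)"
  proof -
    have "diagonal_pairs N \<inter> {t. t \<in> ?A} = ?A" by blast
    then show ?thesis
      using fin by (simp only: of_bool_def sum.If_cases sum_constant sum.neutral_const mult_1_right
        mult_zero_right add_0_right)
  qed
  \<comment> \<open>The initial 1 of the ancilla is absorbed as a \<open>Suc\<close>, which
    exchanges odd and even.\<close>
  finally have val: "final_ancillas N (row_configuration N r) (Diag k) = 1 \<longleftrightarrow> even (card ?A)"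
    using of_nat_bit_eq_1_iff[of "Suc (card ?A)"] by simp
  have "t = t'" if "t \<in> ?A" "t' \<in> ?A" for t t'
  proof -
    obtain i j x y where t: "t = (i, j, x, y)" by (cases t)
    obtain i' j' x' y' where t': "t' = (i', j', x', y')" by (cases t')
    have ij: "1 \<le> i" "i < j" "j \<le> N" "diag_index N i j = k" "x = r i" "y = r j"
      using \<open>t \<in> ?A\<close> by (simp_all add: t diagonal_pairs_def)
    have ij': "1 \<le> i'" "i' < j'" "j' \<le> N" "diag_index N i' j' = k" "x' = r i'" "y' = r j'"
      using \<open>t' \<in> ?A\<close> by (simp_all add: t' diagonal_pairs_def)
    have "i = i' \<and> j = j'"
      using ij(4) ij'(4) by (intro diag_index_inject[OF ij(1-3) ij'(1-3)]) simp
    then show ?thesis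
      by (simp add: t t' ij(5,6) ij'(5,6))
  qed
  then have "card ?A \<le> 1"
    using finA by (simp add: card_le_Suc0_iff_eq)
  then have "even (card ?A) \<longleftrightarrow> ?A = {}"
  proof -
    have "even n \<longleftrightarrow> n = 0" if "n \<le> 1" for n :: nat
      using that by presburger
    from this[OF \<open>card ?A \<le> 1\<close>] card_0_eq[OF finA] show ?thesis
      by (rule trans)
  qed
  also have "\<dots> \<longleftrightarrow> (\<forall>i\<in>{1..N}. \<forall>j\<in>{1..N}. i < j \<and> diag_index N i j = k \<longrightarrow>
      \<bar>int (r i) - int (r j)\<bar> \<noteq> int j - int i)" (is "_ \<longleftrightarrow> ?R")
  proof
    assume empty: "?A = {}"
    show ?R
    proof (intro ballI impI notI)
      fix i j assume ij: "i \<in> {1..N}" "j \<in> {1..N}" "i < j \<and> diag_index N i j = k"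
        "\<bar>int (r i) - int (r j)\<bar> = int j - int i"
      have "r i \<in> {1..N}" "r j \<in> {1..N}"
        using assms(2) ij(1,2) by blast+
      with ij have "(i, j, r i, r j) \<in> ?A"
        by (simp add: diagonal_pairs_def)
      with empty show False by blast
    qed
  next
    assume R: ?R
    have False if "(i, j, x, y) \<in> ?A" for i j x y
    proof -
      have xy: "x = r i" "y = r j"
        using that by blast+
      have "i \<in> {1..N}" "j \<in> {1..N}" "i < j \<and> diag_index N i j = k"
        "\<bar>int (r i) - int (r j)\<bar> = int j - int i"
        using that unfolding xy by (simp_all add: diagonal_pairs_def)
      with R show False by blast
    qed
    then show "?A = {}" by auto
  qed
  finally show ?thesis using val by simp
qed

lemma final_ancillas_iff_queens_solution:
  assumes "N \<ge> 1" "r \<in> {1..N} \<rightarrow> {1..N}"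
  shows "(\<forall>q\<in>ancillas N. final_ancillas N (row_configuration N r) q = 1) \<longleftrightarrow>
    queens_solution N (encoded_configuration (row_configuration N r))"
proof -
  let ?a = "final_ancillas N (row_configuration N r)"
  let ?D = "\<lambda>i j. \<bar>int (r i) - int (r j)\<bar> \<noteq> int j - int i"
  have "(\<forall>y\<in>{1..N - 1}. ?a (Col y) = 1) \<longleftrightarrow> (\<forall>y\<in>{1..N}. card {x\<in>{1..N}. r x = y} = 1)"
    using all_fibres_singleton_iff_odd[OF assms] final_ancillas_Col by simp
  moreover have "(\<forall>k\<in>{1..N * (N - 1) div 2}. ?a (Diag k) = 1) \<longleftrightarrow>
      (\<forall>i\<in>{1..N}. \<forall>j\<in>{1..N}. i < j \<longrightarrow> ?D i j)" (is "?L \<longleftrightarrow> ?R")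
  proof -
    have a: "?a (Diag k) = 1 \<longleftrightarrow> (\<forall>i\<in>{1..N}. \<forall>j\<in>{1..N}. i < j \<and> diag_index N i j = k \<longrightarrow> ?D i j)"
      if "k \<in> {1..N * (N - 1) div 2}" for k
      using that by (intro final_ancillas_Diag assms(2)) (auto simp: ancillas_def diagonal_ancillas_def)
    show ?thesis
    proof
      assume ?L
      show ?R
      proof (intro ballI impI)
        fix i j assume ij: "i \<in> {1..N}" "j \<in> {1..N}" "i < j"
        \<comment> \<open>Each pair of rows owns an existing ancilla, so no conflict escapes the
          quantifier over \<open>k\<close>.\<close>
        then have "diag_index N i j \<in> {1..N * (N - 1) div 2}"
          by (intro diag_index_bounds) auto
        with \<open>?L\<close> a ij show "?D i j" by blast
      qed
    qed (use a in blast)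
  qed
  moreover have "(\<forall>q\<in>ancillas N. ?a q = 1) \<longleftrightarrow>
      (\<forall>y\<in>{1..N - 1}. ?a (Col y) = 1) \<and> (\<forall>k\<in>{1..N * (N - 1) div 2}. ?a (Diag k) = 1)"
    unfolding ancillas_def column_ancillas_def diagonal_ancillas_def by blast
  moreover have "queens_solution N (encoded_configuration (row_configuration N r)) \<longleftrightarrow>
      (\<forall>y\<in>{1..N}. card {x\<in>{1..N}. r x = y} = 1) \<and> (\<forall>i\<in>{1..N}. \<forall>j\<in>{1..N}. i < j \<longrightarrow> ?D i j)"
    using assms(2)
    by (intro queens_solution_row_configuration) (auto simp: encoded_configuration_def row_configuration_apply)
  ultimately show ?thesis by simp
qed

section \<open>Qubit counts\<close>

lemma card_system_qubits: "card (system_qubits N) = N ^ 2"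
proof -
  have "system_qubits N = (\<lambda>(x, y). Sys x y) ` ({1..N} \<times> {1..N})"
    by (auto simp: system_qubits_eq)
  then show ?thesis
    by (simp add: card_image inj_on_def card_cartesian_product power2_eq_square split_beta prod_eq_iff)
qed

lemma card_ancillas: "card (ancillas N) = (N - 1) + N * (N - 1) div 2"
  unfolding ancillas_def column_ancillas_def diagonal_ancillas_def
  by (subst card_Un_disjoint) (auto simp: card_image inj_on_def)

text \<open>One of two consecutive numbers is even, so the \<open>div\<close> is exact. For
  \<open>N = 0\<close> the truncated \<open>N - 1\<close> would be 0 and the count 0, while the
  formula gives -1.\<close>

lemma real_card_ancillas:
  assumes "N \<ge> 1"
  shows "real (card (ancillas N)) = real N ^ 2 / 2 + real N / 2 - 1"
proof -
  have "even (N * (N - 1))" by (cases N) auto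
  then have "real (N * (N - 1) div 2) = real (N * (N - 1)) / 2"
    by (simp add: real_of_nat_div)
  then show ?thesis
    using assms by (simp add: card_ancillas of_nat_diff field_simps power2_eq_square)
qed

lemma real_num_qubits:
  assumes "N \<ge> 1"
  shows "real (num_qubits (queens_circuit N)) = 3 / 2 * real N ^ 2 + real N / 2 - 1"
proof -
  have "finite (system_qubits N)" "finite (ancillas N)"
    by (auto simp: system_qubits_def block_def ancillas_def column_ancillas_def diagonal_ancillas_def)
  then have "num_qubits (queens_circuit N) = card (system_qubits N) + card (ancillas N)"
    by (simp add: num_qubits_def queens_circuit_def card_Un_disjoint system_inter_ancillas)
  then show ?thesis
    using real_card_ancillas[OF assms] by (simp add: card_system_qubits)
qed

lemma num_qubits_bigo: "(\<lambda>n. real (num_qubits (queens_circuit n))) \<in> O(\<lambda>n. real n ^ 2)"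
proof (rule bigoI[where c = 2])
  show "\<forall>\<^sub>F n in sequentially. norm (real (num_qubits (queens_circuit n))) \<le> 2 * norm (real n ^ 2)"
    using eventually_ge_at_top[of 1]
  proof eventually_elim
    case (elim n)
    \<comment> \<open>The constant 2 arises as 3/2 + 1/2, bounding the linear term n/2 by half of
      the square.\<close>
    have "real n \<le> real n ^ 2"
      using elim by (simp add: power2_eq_square)
    then have "real (num_qubits (queens_circuit n)) \<le> 2 * real n ^ 2"
      using real_num_qubits[OF elim] by linarith
    then show ?case by simp
  qed
qed

theorem mainTheorem2:
  fixes N :: nat
  assumes "N \<ge> 1"
  shows
    "real (num_qubits (queens_circuit N)) = 3 / 2 * real N ^ 2 + real N / 2 - 1 \<and>
     register (queens_circuit N) = system_qubits N \<union> ancillas N \<and>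
     system_qubits N \<inter> ancillas N = {} \<and>
     card (system_qubits N) = N ^ 2 \<and>
     real (card (ancillas N)) = real N ^ 2 / 2 + real N / 2 - 1 \<and>
     (\<lambda>n. real (num_qubits (queens_circuit n))) \<in> O(\<lambda>n. real n ^ 2) \<and>
     card (occurring (Psi N)) = N ^ N \<and>
     (\<exists>a. (\<forall>s\<in>occurring (Psi N). a s \<in> basis (ancillas N)) \<and>
          output_state (queens_circuit N) =
            (\<lambda>b. \<Sum>s\<in>occurring (Psi N).
                   Psi N s * tensor (system_qubits N) (ket s) (ancillas N) (ket (a s)) b) \<and>
          (\<forall>s\<in>occurring (Psi N).
             (\<forall>q\<in>ancillas N. a s q = 1) \<longleftrightarrow> queens_solution N (encoded_configuration s)) \<and>
          (\<forall>s\<in>occurring (Psi N).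
             \<not> queens_solution N (encoded_configuration s) \<longrightarrow> (\<exists>q\<in>ancillas N. a s q = 0)))"
proof -
  let ?S = "system_qubits N" and ?A = "ancillas N"
  have fin: "finite (occurring (Psi N))"
    by (simp add: occurring_Psi[OF assms] finite_PiE)
  have basis: "s \<in> basis ?S" if "s \<in> occurring (Psi N)" for s
    using that row_configuration_basis by (auto simp: occurring_Psi[OF assms])
  \<comment> \<open>The input is expanded before any gate acts, so the amplitudes of
    \<open>Psi N\<close> become coefficients that pass through the whole circuit unchanged.\<close>
  have "output_state (queens_circuit N) = fold apply_gate (gates (queens_circuit N))
      (\<lambda>b. \<Sum>s\<in>occurring (Psi N). Psi N s * tensor ?S (ket s) ?A (ket (initial_ancillas N)) b)"
    by (simp add: output_state_def queens_circuit_def flip: tensor_expand[OF fin])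
  also have "\<dots> = (\<lambda>b. \<Sum>s\<in>occurring (Psi N).
      Psi N s * tensor ?S (ket s) ?A (ket (final_ancillas N s)) b)"
    unfolding fold_apply_gate_linear
    by (intro ext sum.cong refl) (simp add: fold_gates_queens_circuit basis)
  finally have out: "output_state (queens_circuit N) = \<dots>" .
  have anc: "final_ancillas N s \<in> basis ?A" for s
    by (simp add: final_ancillas_def basis_def)
  have sol: "(\<forall>q\<in>?A. final_ancillas N s q = 1) \<longleftrightarrow> queens_solution N (encoded_configuration s)"
    if "s \<in> occurring (Psi N)" for s
    using that final_ancillas_iff_queens_solution[OF assms]
    by (auto simp: occurring_Psi[OF assms] PiE_def)
  \<comment> \<open>By \<open>sol\<close> some ancilla differs from 1, and a bit other than 1 is
    0.\<close>
  have unsol: "\<exists>q\<in>?A. final_ancillas N s q = 0"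
    if "s \<in> occurring (Psi N)" "\<not> queens_solution N (encoded_configuration s)" for s
    using sol that by (metis bit_not_one_iff)
  have reg: "register (queens_circuit N) = ?S \<union> ?A"
    by (simp add: queens_circuit_def)
  show ?thesis
  proof (intro conjI exI[of _ "final_ancillas N"] ballI impI, goal_cases)
    case 1 show ?case by (rule real_num_qubits[OF assms])
  next
    case 2 show ?case by (rule reg)
  next
    case 3 show ?case by (rule system_inter_ancillas)
  next
    case 4 show ?case by (rule card_system_qubits)
  next
    case 5 show ?case by (rule real_card_ancillas[OF assms])
  next
    case 6 show ?case by (rule num_qubits_bigo)
  next
    case 7 show ?case by (rule card_occurring_Psi[OF assms])
  next
    case 8 show ?case by (rule anc)
  next
    case 9 show ?case by (rule out)
  next
    case 10 then show ?case by (rule sol)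
  next
    case 11 then show ?case by (rule unsol)
  qed
qed

end
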